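(* Let $N\ge 3$ be an integer. Let $m=(N-3)/2$ if $N$ is odd and $m=(N-4)/2$ if $N$ is even. Let $\{\nu_j\}_{j=1}^{m}$ be the set of positive roots of the equation $U'_{N-2}(x)=0$, let $\gamma_j=1-2\nu_j^2$ for $j=1,\ldots,m$, and let $q(z)=1+\kappa(z-z^{N-1})-z^N$. Then: (i) if $\kappa=-N/(N-2)$ and $N$ is odd, \[ q(z)=(1-z)^3\prod_{j=1}^{(N-3)/2}\left[1+z^2+2z\gamma_j\right]; \] (ii) if $\kappa=-N/(N-2)$ and $N$ is even, \[ q(z)=(1+z)(1-z)^3\prod_{j=1}^{(N-4)/2}\left[1+z^2+2z\gamma_j\right]; \] (iii) if $\kappa=N/(N-2)$ and $N$ is even, \[ q(z)=(1-z)(1+z)^3\prod_{j=1}^{(N-4)/2}\left[1+z^2-2z\gamma_j\right]. \]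
   Context: $U_j$ denotes the Chebyshev polynomial of the second kind of degree $j$, defined by $U_j(\cos t)=\frac{\sin (j+1)t}{\sin t}$, so that $U_j(x)=2^jx^j+\ldots$; $U'_j$ denotes its derivative. Empty products equal $1$. *)

theory Defs
  imports "HOL-Analysis.Analysis" "HOL-Computational_Algebra.Polynomial"
begin

definition cheb_U :: "nat \<Rightarrow> real poly" where
  "cheb_U j = (THE p. \<forall>t. sin t \<noteq> 0 \<longrightarrow> poly p (cos t) = sin ((real j + 1) * t) / sin t)"

definition q_poly :: "nat \<Rightarrow> real \<Rightarrow> complex \<Rightarrow> complex" where
  "q_poly N \<kappa> z = 1 + of_real \<kappa> * (z - z ^ (N - 1)) - z ^ N"

text \<open>The description defining \<open>cheb_U\<close> is proper: the witness is given by the three-term recurrence.\<close>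

fun cheb_U_rec :: "nat \<Rightarrow> real poly" where
  "cheb_U_rec 0 = 1"
| "cheb_U_rec (Suc 0) = [:0, 2:]"
| "cheb_U_rec (Suc (Suc j)) = [:0, 2:] * cheb_U_rec (Suc j) - cheb_U_rec j"

lemma cheb_U_rec_sin: "poly (cheb_U_rec j) (cos t) * sin t = sin ((real j + 1) * t)"
proof (induction j rule: cheb_U_rec.induct)
  case 2
  then show ?case using sin_double[of t] by simp
next
  case (3 j)
  have "sin ((real j + 3) * t) + sin ((real j + 1) * t) = 2 * cos t * sin ((real j + 2) * t)"
    using sin_add[of "(real j + 2) * t" t] sin_diff[of "(real j + 2) * t" t]
    by (simp add: algebra_simps)
  with 3 show ?case by (simp add: algebra_simps)
qed simp

lemma poly_eq_on_cos:
  fixes p r :: "real poly"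
  assumes "\<And>t. sin t \<noteq> 0 \<Longrightarrow> poly p (cos t) = poly r (cos t)"
  shows "p = r"
proof (rule ccontr)
  assume "p \<noteq> r"
  then have "finite {x. poly (p - r) x = 0}" by (intro poly_roots_finite) simp
  moreover have "{-1<..<1} \<subseteq> {x. poly (p - r) x = 0}"
  proof
    fix x :: real assume x: "x \<in> {-1<..<1}"
    then have "sin (arccos x) \<noteq> 0" by (intro sin_arccos_nonzero) auto
    with assms[of "arccos x"] x show "x \<in> {x. poly (p - r) x = 0}" by simp
  qed
  ultimately have "finite {-1<..<1::real}" by (rule rev_finite_subset)
  then show False by (simp add: infinite_Ioo)
qed

lemma cheb_U_eq_rec: "cheb_U j = cheb_U_rec j"
  unfolding cheb_U_def
proof (rule the_equality)
  show *: "\<forall>t. sin t \<noteq> 0 \<longrightarrow> poly (cheb_U_rec j) (cos t) = sin ((real j + 1) * t) / sin t"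
    by (simp add: cheb_U_rec_sin[symmetric])
  show "p = cheb_U_rec j"
    if "\<forall>t. sin t \<noteq> 0 \<longrightarrow> poly p (cos t) = sin ((real j + 1) * t) / sin t" for p
    using that * by (intro poly_eq_on_cos) auto
qed

lemma cheb_U_cos: "sin t \<noteq> 0 \<Longrightarrow> poly (cheb_U j) (cos t) = sin ((real j + 1) * t) / sin t"
  by (simp add: cheb_U_eq_rec cheb_U_rec_sin[symmetric])

lemma cheb_U_degree_lead: "degree (cheb_U j) = j" "lead_coeff (cheb_U j) = 2 ^ j"
proof -
  have "degree (cheb_U_rec j) \<le> j \<and> coeff (cheb_U_rec j) j = 2 ^ j"
  proof (induction j rule: cheb_U_rec.induct)
    case (3 j)
    have "degree (cheb_U_rec (Suc (Suc j))) \<le> Suc (Suc j)"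
      using 3 degree_mult_le[of "[:0, 2:]" "cheb_U_rec (Suc j)"]
      by (auto intro!: degree_diff_le)
    moreover have "coeff (cheb_U_rec j) (Suc (Suc j)) = 0"
      using 3 by (intro coeff_eq_0) auto
    ultimately show ?case using 3 by simp
  qed auto
  then have "degree (cheb_U j) = j \<and> coeff (cheb_U j) j = 2 ^ j"
    by (metis cheb_U_eq_rec le_antisym le_degree power_not_zero zero_neq_numeral)
  then show "degree (cheb_U j) = j" "lead_coeff (cheb_U j) = 2 ^ j" by auto
qed

end

theory Submission
  imports Defs
begin

text \<open>
  Put \<open>n = N - 2\<close> and \<open>x = cos t\<close>. Differentiating \<open>U\<^sub>n(cos t) sin t = sin ((n + 1) t)\<close> gives
  \<open>U\<^sub>n'(cos t) sin\<^sup>3 t = - (n / 2) (sin (N t) + \<kappa> sin ((N - 2) t))\<close> for \<open>\<kappa> = - N / (N - 2)\<close>. With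
  \<open>z = w\<^sup>2\<close> and \<open>w = exp (i t)\<close> for complex \<open>t\<close>, this says that \<open>q z\<close> equals
  \<open>(1 - z)\<^sup>3 w\<^sup>N\<^sup>-\<^sup>3 U\<^sub>n'(x) / (2 n)\<close>. By Rolle's theorem and a degree count the roots of \<open>U\<^sub>n'\<close> are
  real and simple, and they are symmetric about \<open>0\<close>, so \<open>U\<^sub>n'(x)\<close> is a product of factors
  \<open>x\<^sup>2 - \<nu>\<^sup>2\<close> and possibly \<open>x\<close>; finally \<open>4 z (x\<^sup>2 - \<nu>\<^sup>2) = 1 + z\<^sup>2 + 2 z (1 - 2 \<nu>\<^sup>2)\<close> and
  \<open>2 w x = 1 + z\<close>. The case \<open>\<kappa> = N / (N - 2)\<close> follows by replacing \<open>z\<close> with \<open>- z\<close>.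
\<close>

section \<open>Real polynomials read over the complex numbers\<close>

lemma map_poly_of_real_smult:
  "map_poly of_real (smult c p) = smult (of_real c :: complex) (map_poly of_real p)"
  by (simp add: poly_eq_iff coeff_map_poly)

lemma map_poly_of_real_diff:
  "map_poly of_real (p - q) = (map_poly of_real p - map_poly of_real q :: complex poly)"
  by (simp add: poly_eq_iff coeff_map_poly)

lemma map_poly_of_real_mult:
  "map_poly of_real (p * q) = (map_poly of_real p * map_poly of_real q :: complex poly)"
  by (simp add: poly_eq_iff coeff_map_poly coeff_mult)

lemma map_poly_of_real_prod:
  "map_poly of_real (\<Prod>i\<in>A. f i) = (\<Prod>i\<in>A. map_poly of_real (f i) :: complex poly)"
  by (induction A rule: infinite_finite_induct) (simp_all add: map_poly_of_real_mult)

lemma map_poly_of_real_pderiv: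
  "map_poly of_real (pderiv p) = (pderiv (map_poly of_real p) :: complex poly)"
  by (simp add: poly_eq_iff coeff_map_poly coeff_pderiv)

section \<open>Trigonometric identities at complex arguments\<close>

text \<open>The recurrence argument is repeated for complex \<open>t\<close>, because
  \<open>exp (\<i> * t)\<close> must reach every nonzero complex number.\<close>

lemma map_poly_of_real_cheb_U_sin:
  fixes t :: complex
  shows "poly (map_poly of_real (cheb_U j)) (cos t) * sin t = sin ((of_nat j + 1) * t)"
  unfolding cheb_U_eq_rec
proof (induction j rule: cheb_U_rec.induct)
  case 2
  then show ?case using sin_double[of t] by (simp add: map_poly_pCons)
next
  case (3 j)
  have "sin ((of_nat j + 3) * t) + sin ((of_nat j + 1) * t) = 2 * cos t * sin ((of_nat j + 2) * t)"
    using sin_add[of "(of_nat j + 2) * t" t] sin_diff[of "(of_nat j + 2) * t" t]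
    by (simp add: algebra_simps)
  with 3 show ?case
    by (simp add: algebra_simps map_poly_of_real_diff map_poly_of_real_smult map_poly_pCons)
qed simp

text \<open>Differentiate the previous identity and multiply once more by \<open>sin t\<close>: then
  U_j itself can be eliminated, and no division by \<open>sin t\<close> occurs.\<close>

lemma pderiv_cheb_U_sin:
  fixes t :: complex
  shows "poly (map_poly of_real (pderiv (cheb_U j))) (cos t) * sin t ^ 3 =
    sin ((of_nat j + 1) * t) * cos t - (of_nat j + 1) * cos ((of_nat j + 1) * t) * sin t"
proof -
  let ?p = "map_poly of_real (cheb_U j) :: complex poly"
  have "((\<lambda>t. poly ?p (cos t) * sin t) has_field_derivative
      (poly (pderiv ?p) (cos t) * (- sin t)) * sin t + cos t * poly ?p (cos t)) (at t)"
    by (intro DERIV_mult DERIV_sin DERIV_chain2[OF poly_DERIV DERIV_cos])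
  moreover have "((\<lambda>t. poly ?p (cos t) * sin t) has_field_derivative
      (of_nat j + 1) * cos ((of_nat j + 1) * t)) (at t)"
    unfolding map_poly_of_real_cheb_U_sin by (auto intro!: derivative_eq_intros)
  ultimately have "(poly (pderiv ?p) (cos t) * (- sin t)) * sin t + cos t * poly ?p (cos t) =
      (of_nat j + 1) * cos ((of_nat j + 1) * t)"
    by (rule DERIV_unique)
  then have "((poly (pderiv ?p) (cos t) * (- sin t)) * sin t + cos t * poly ?p (cos t)) * sin t =
      (of_nat j + 1) * cos ((of_nat j + 1) * t) * sin t"
    by simp
  moreover have "cos t * poly ?p (cos t) * sin t = sin ((of_nat j + 1) * t) * cos t"
    by (simp flip: map_poly_of_real_cheb_U_sin)
  ultimately show ?thesis
    unfolding map_poly_of_real_pderiv by (simp add: algebra_simps power3_eq_cube)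
qed

text \<open>This is the previous identity with \<open>w = exp (\<i> * t)\<close>, where
  \<open>w - 1 / w\<close> is \<open>2 * \<i> * sin t\<close>.\<close>

lemma pderiv_cheb_U_joukowski:
  fixes w :: complex
  assumes "w \<noteq> 0"
  shows "poly (map_poly of_real (pderiv (cheb_U j))) ((w + 1 / w) / 2) * (w - 1 / w) ^ 3 =
    2 * (of_nat j * (w ^ (j + 2) - 1 / w ^ (j + 2)) - (of_nat j + 2) * (w ^ j - 1 / w ^ j))"
proof -
  obtain t where t: "w = exp (\<i> * t)"
  proof
    show "w = exp (\<i> * (Ln w / \<i>))" using assms by simp
  qed
  define v where "v = 1 / w"
  have vw: "v * w = 1" using assms by (simp add: v_def)
  have v: "exp (- (\<i> * t)) = v" by (simp add: v_def t exp_minus field_simps)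
  have pw: "exp (\<i> * ((of_nat j + 1) * t)) = w ^ (j + 1)"
    using exp_of_nat_mult[of "j + 1" "\<i> * t"] by (simp add: t algebra_simps)
  have pv: "exp (- (\<i> * ((of_nat j + 1) * t))) = v ^ (j + 1)"
    using exp_of_nat_mult[of "j + 1" "- (\<i> * t)"] by (simp add: v algebra_simps)
  have cos: "cos t = (w + v) / 2" and sin: "sin t = (w - v) / (2 * \<i>)"
    and cosj: "cos ((of_nat j + 1) * t) = (w ^ (j + 1) + v ^ (j + 1)) / 2"
    and sinj: "sin ((of_nat j + 1) * t) = (w ^ (j + 1) - v ^ (j + 1)) / (2 * \<i>)"
    using v pw pv t by (simp_all add: cos_exp_eq sin_exp_eq)
  have sin3: "sin t ^ 3 = (w - v) ^ 3 * \<i> / 8"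
    unfolding sin by (simp add: power3_eq_cube field_simps)
  let ?P = "poly (map_poly of_real (pderiv (cheb_U j))) ((w + v) / 2)"
  have "?P * (w - v) ^ 3 = (-8 * \<i>) * (?P * ((w - v) ^ 3 * \<i> / 8))"
    by (simp add: algebra_simps)
  also have "\<dots> = (-8 * \<i>) * ((w ^ (j + 1) - v ^ (j + 1)) / (2 * \<i>) * ((w + v) / 2) -
      (of_nat j + 1) * ((w ^ (j + 1) + v ^ (j + 1)) / 2) * ((w - v) / (2 * \<i>)))"
    using pderiv_cheb_U_sin[of j t] unfolding sin3 cosj sinj by (simp add: cos sin)
  also have "\<dots> = 2 * ((of_nat j + 1) * (w ^ (j + 1) + v ^ (j + 1)) * (w - v) -
      (w ^ (j + 1) - v ^ (j + 1)) * (w + v))"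
    by (simp add: field_simps)
  \<comment> \<open>This is a polynomial identity in independent \<open>v\<close> and
    \<open>w\<close>; the factors \<open>v * w\<close> are kept so that \<open>vw\<close> can turn
    them into 1.\<close>
  also have "\<dots> = 2 * (of_nat j * (w ^ (j + 2) - v ^ (j + 2)) -
      (of_nat j + 2) * ((v * w) * w ^ j - (v * w) * v ^ j))"
    by (simp add: algebra_simps)
  finally show ?thesis unfolding vw by (simp add: v_def power_one_over)
qed

section \<open>Parity and real roots of U_n'\<close>

text \<open>The factor 2x in the recurrence alternates the parity.\<close>

lemma cheb_U_uminus: "pcompose (cheb_U j) [:0, -1:] = smult ((-1) ^ j) (cheb_U j)"
  unfolding cheb_U_eq_rec
  by (induction j rule: cheb_U_rec.induct)
     (simp_all add: pcompose_diff pcompose_pCons pcompose_smult pcompose_1 one_pCons smult_diff_right mult.commute)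

lemma pderiv_cheb_U_root_uminus:
  "poly (pderiv (cheb_U j)) (- x) = 0 \<longleftrightarrow> poly (pderiv (cheb_U j)) x = 0"
proof -
  have "pderiv (pcompose (cheb_U j) [:0, -1:]) = smult ((-1) ^ j) (pderiv (cheb_U j))"
    by (simp add: cheb_U_uminus pderiv_smult)
  then have "poly (pderiv (pcompose (cheb_U j) [:0, -1:])) x = (-1) ^ j * poly (pderiv (cheb_U j)) x"
    by simp
  then have "- poly (pderiv (cheb_U j)) (- x) = (-1) ^ j * poly (pderiv (cheb_U j)) x"
    by (simp add: pderiv_pcompose poly_pcompose pderiv_pCons)
  then show ?thesis by (metis mult_eq_0_iff neg_equal_0_iff_equal power_not_zero zero_neq_neg_one)
qed

lemma degree_pderiv_cheb_U: "degree (pderiv (cheb_U n)) = n - 1"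
  by (simp add: degree_pderiv cheb_U_degree_lead)

lemma lead_coeff_pderiv_cheb_U:
  assumes "n \<ge> 1"
  shows "lead_coeff (pderiv (cheb_U n)) = real n * 2 ^ n"
  using assms cheb_U_degree_lead[of n] by (simp add: degree_pderiv_cheb_U coeff_pderiv)

lemma pderiv_cheb_U_nonzero: "n \<ge> 1 \<Longrightarrow> pderiv (cheb_U n) \<noteq> 0"
  using cheb_U_degree_lead(1)[of n] by (auto simp: pderiv_eq_0_iff)

text \<open>The n zeros cos(k pi / (n + 1)) of U_n bound n - 1 disjoint open intervals. Rolle's
  theorem puts a root of U_n' in each, and the degree allows no more.\<close>

lemma card_roots_pderiv_cheb_U:
  assumes "n \<ge> 1"
  shows "card {x. poly (pderiv (cheb_U n)) x = 0} = n - 1"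
proof -
  let ?Z = "{x. poly (pderiv (cheb_U n)) x = 0}"
  have fin: "finite ?Z" using pderiv_cheb_U_nonzero[OF assms] by (rule poly_roots_finite)
  define a where "a k = real k * pi / (real n + 1)" for k
  have a: "0 < a k" "a k < pi" if "k \<in> {1..n}" for k
    using that mult_strict_left_mono[of "real k" "real n + 1" pi]
    by (auto simp: a_def pos_divide_less_eq mult.commute)
  have cos_less: "cos (a k) < cos (a l)" if "l < k" "l \<in> {1..n}" "k \<in> {1..n}" for k l
    using a[OF that(2)] a[OF that(3)] that(1)
    by (intro cos_monotone_0_pi) (auto simp: a_def divide_strict_right_mono)
  have root: "poly (cheb_U n) (cos (a k)) = 0" if "k \<in> {1..n}" for k
  proof -
    have "sin (a k) > 0" using a[OF that] by (intro sin_gt_zero) auto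
    moreover have "(real n + 1) * a k = real k * pi" by (simp add: a_def field_simps)
    ultimately show ?thesis by (simp add: cheb_U_cos)
  qed
  have "\<exists>y. cos (a (Suc k)) < y \<and> y < cos (a k) \<and> poly (pderiv (cheb_U n)) y = 0"
    if "k \<in> {1..<n}" for k
  proof -
    have less: "cos (a (Suc k)) < cos (a k)" using that by (intro cos_less) auto
    then show ?thesis
      using poly_MVT[OF less, of "cheb_U n"] root[of k] root[of "Suc k"] that by auto
  qed
  then obtain y where y: "\<And>k. k \<in> {1..<n} \<Longrightarrow>
      cos (a (Suc k)) < y k \<and> y k < cos (a k) \<and> poly (pderiv (cheb_U n)) (y k) = 0"
    by metis
  have y_less: "y k < y l" if "l < k" "l \<in> {1..<n}" "k \<in> {1..<n}" for k l
  proof -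
    \<comment> \<open>Neighbouring intervals share an endpoint when \<open>k = Suc l\<close>;
      strictness comes from the bounds on \<open>y\<close>.\<close>
    have "cos (a k) \<le> cos (a (Suc l))"
      using that cos_less[of "Suc l" k] by (cases "k = Suc l") auto
    then show ?thesis using y[OF that(2)] y[OF that(3)] by linarith
  qed
  have "inj_on y {1..<n}"
  proof (rule inj_onI)
    fix k l assume "k \<in> {1..<n}" "l \<in> {1..<n}" "y k = y l"
    then show "k = l" using y_less[of k l] y_less[of l k] by (cases k l rule: linorder_cases) auto
  qed
  then have "n - 1 = card (y ` {1..<n})" by (simp add: card_image)
  also have "\<dots> \<le> card ?Z" using y fin by (intro card_mono) auto
  finally have "n - 1 \<le> card ?Z" .
  moreover have "card ?Z \<le> n - 1"
    using card_poly_roots_bound[OF pderiv_cheb_U_nonzero[OF assms]]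
    by (simp add: degree_pderiv_cheb_U)
  ultimately show ?thesis by simp
qed

section \<open>Factorization over a symmetric set of roots\<close>

text \<open>Both sides agree at \<open>degree p\<close> points and in the coefficient of that
  degree, so their difference has more roots than its degree permits.\<close>

lemma poly_split_distinct_roots:
  fixes p :: "'a :: idom poly"
  assumes "p \<noteq> 0" "card {x. poly p x = 0} = degree p"
  shows "p = smult (lead_coeff p) (\<Prod>r | poly p r = 0. [:- r, 1:])"
proof (rule poly_eqI_degree_lead_coeff)
  let ?q = "smult (lead_coeff p) (\<Prod>r | poly p r = 0. [:- r, 1:])"
  have fin: "finite {x. poly p x = 0}" using assms(1) by (rule poly_roots_finite)
  have deg: "degree (\<Prod>r | poly p r = 0. [:- r, 1:]) = degree p"
    by (subst degree_prod_eq_sum_degree) (auto simp: assms)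
  show "coeff p (degree p) = coeff ?q (degree p)"
    using lead_coeff_prod[of "\<lambda>r. [:- r, 1:]" "{r. poly p r = 0}"] by (simp add: deg)
  show "card {x. poly p x = 0} \<ge> degree p" using assms by simp
  show "degree p \<le> degree p" "degree ?q \<le> degree p" using deg by auto
  show "poly p z = poly ?q z" if "z \<in> {x. poly p x = 0}" for z
    using that fin by (auto simp: poly_prod intro!: prod_zero)
qed

text \<open>Pair x with -x, using (z + x)(z - x) = z^2 - x^2; only 0 can remain unpaired.\<close>

lemma symmetric_set_decomp:
  fixes S :: "real set"
  assumes "finite S" "\<And>x. - x \<in> S \<longleftrightarrow> x \<in> S"
  defines "R \<equiv> {x \<in> S. x > 0}"
  shows "card S = 2 * card R + (if 0 \<in> S then 1 else 0)"
    and "(\<Prod>x\<in>S. of_real x + z) =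
      (if 0 \<in> S then z else 1) * (\<Prod>x\<in>R. z\<^sup>2 - (of_real x)\<^sup>2 :: complex)"
proof -
  let ?Z = "S \<inter> {0}"
  have S: "S = ?Z \<union> (R \<union> uminus ` R)"
  proof (intro equalityI subsetI)
    fix x assume "x \<in> S"
    then show "x \<in> ?Z \<union> (R \<union> uminus ` R)"
      using assms(2)[of x] image_eqI[of x uminus "- x" R]
      by (cases x "0 :: real" rule: linorder_cases) (auto simp: R_def)
  qed (auto simp: R_def assms(2))
  have fin: "finite R" "finite (uminus ` R)" "finite ?Z" using assms(1) by (auto simp: R_def)
  have disj: "R \<inter> uminus ` R = {}" "?Z \<inter> (R \<union> uminus ` R) = {}" by (auto simp: R_def)
  have Z: "?Z = (if 0 \<in> S then {0} else {})" by auto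
  have "card S = card ?Z + (card R + card (uminus ` R))"
    by (subst S) (simp add: card_Un_disjoint fin disj)
  then show "card S = 2 * card R + (if 0 \<in> S then 1 else 0)"
    by (simp add: Z card_image)
  have "(\<Prod>x\<in>S. of_real x + z) =
      (\<Prod>x\<in>?Z. of_real x + z) * ((\<Prod>x\<in>R. of_real x + z) * (\<Prod>x\<in>uminus ` R. of_real x + z))"
    by (subst S) (simp add: prod.union_disjoint fin disj del: Int_insert_right)
  also have "(\<Prod>x\<in>uminus ` R. of_real x + z) = (\<Prod>x\<in>R. z - of_real x)"
    by (simp add: prod.reindex)
  also have "(\<Prod>x\<in>R. of_real x + z) * (\<Prod>x\<in>R. z - of_real x) = (\<Prod>x\<in>R. z\<^sup>2 - (of_real x)\<^sup>2)"
    by (simp flip: prod.distrib add: algebra_simps power2_eq_square)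
  finally show "(\<Prod>x\<in>S. of_real x + z) =
      (if 0 \<in> S then z else 1) * (\<Prod>x\<in>R. z\<^sup>2 - (of_real x)\<^sup>2 :: complex)"
    by (simp add: Z)
qed

lemma
  assumes "n \<ge> 1"
  defines "R \<equiv> {x. x > 0 \<and> poly (pderiv (cheb_U n)) x = 0}"
  shows finite_pos_roots_pderiv_cheb_U: "finite R"
    and card_pos_roots_pderiv_cheb_U: "card R = (n - 1) div 2"
    and pderiv_cheb_U_factor: "poly (map_poly of_real (pderiv (cheb_U n))) z =
      of_nat n * 2 ^ n * z ^ ((n - 1) mod 2) * (\<Prod>x\<in>R. z\<^sup>2 - (of_real x)\<^sup>2 :: complex)"
proof -
  let ?p = "pderiv (cheb_U n)"
  define S where "S = {x. poly ?p x = 0}"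
  have fin: "finite S"
    unfolding S_def using pderiv_cheb_U_nonzero[OF assms(1)] by (rule poly_roots_finite)
  have sym: "- x \<in> S \<longleftrightarrow> x \<in> S" for x by (simp add: S_def pderiv_cheb_U_root_uminus)
  have R: "R = {x \<in> S. x > 0}" by (auto simp: R_def S_def)
  show "finite R" using fin by (simp add: R)
  have card: "n - 1 = 2 * card R + (if 0 \<in> S then 1 else 0)"
    using symmetric_set_decomp(1)[OF fin sym] card_roots_pderiv_cheb_U[OF assms(1)]
    by (simp add: R S_def)
  then show "card R = (n - 1) div 2" by (simp split: if_splits)
  \<comment> \<open>By the count in \<open>card\<close>, 0 is a root exactly when
    \<open>n - 1\<close> is odd.\<close>
  have par: "(if 0 \<in> S then z else 1) = z ^ ((n - 1) mod 2)" for z :: complex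
    using card by (simp split: if_splits)
  have "?p = smult (real n * 2 ^ n) (\<Prod>r\<in>S. [:- r, 1:])"
    unfolding S_def lead_coeff_pderiv_cheb_U[OF assms(1), symmetric]
    by (intro poly_split_distinct_roots pderiv_cheb_U_nonzero[OF assms(1)])
       (simp only: card_roots_pderiv_cheb_U[OF assms(1)] degree_pderiv_cheb_U)
  then have "poly (map_poly of_real ?p) z = of_nat n * 2 ^ n * (\<Prod>r\<in>S. - of_real r + z)"
    by (simp add: map_poly_of_real_smult map_poly_of_real_prod poly_prod map_poly_pCons)
  \<comment> \<open>Reflecting the root set gives the product the form used in
    \<open>symmetric_set_decomp\<close>.\<close>
  also have "(\<Prod>r\<in>S. - of_real r + z) = (\<Prod>r\<in>uminus ` S. of_real r + z)"
    by (simp add: prod.reindex)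
  also have "uminus ` S = S"
    using sym by (auto intro: image_eqI[of _ uminus "- x" for x])
  also have "(\<Prod>r\<in>S. of_real r + z) = z ^ ((n - 1) mod 2) * (\<Prod>x\<in>R. z\<^sup>2 - (of_real x)\<^sup>2)"
    unfolding symmetric_set_decomp(2)[OF fin sym] par R ..
  finally show "poly (map_poly of_real ?p) z =
      of_nat n * 2 ^ n * z ^ ((n - 1) mod 2) * (\<Prod>x\<in>R. z\<^sup>2 - (of_real x)\<^sup>2)"
    by simp
qed

section \<open>Factorization of q\<close>

lemma q_poly_factor:
  fixes n :: nat
  assumes "n \<ge> 1"
  defines "R \<equiv> {x. x > 0 \<and> poly (pderiv (cheb_U n)) x = 0}"
  shows "q_poly (n + 2) (- real (n + 2) / real n) z =
    (1 - z) ^ 3 * (1 + z) ^ ((n - 1) mod 2) * (\<Prod>x\<in>R. 1 + z\<^sup>2 + 2 * z * of_real (1 - 2 * x\<^sup>2))"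
proof (cases "z = 0")
  case True
  then show ?thesis using assms by (simp add: q_poly_def)
next
  case False
  define w where "w = csqrt z"
  have w: "w \<noteq> 0" and z: "z = w\<^sup>2" using False by (auto simp: w_def)
  define x where "x = (w + 1 / w) / 2"
  define e where "e = (n - 1) mod 2"
  define P where "P = poly (map_poly of_real (pderiv (cheb_U n))) x"
  have lin: "2 * w * x = 1 + z"
    using w by (simp add: x_def z field_simps power2_eq_square)
  have quad: "(2 * w)\<^sup>2 * (x\<^sup>2 - (of_real r)\<^sup>2) = 1 + z\<^sup>2 + 2 * z * of_real (1 - 2 * r\<^sup>2)" for r
  proof -
    have "(2 * w)\<^sup>2 * (x\<^sup>2 - (of_real r)\<^sup>2) = (2 * w * x)\<^sup>2 - 4 * z * (of_real r)\<^sup>2"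
      by (simp add: z algebra_simps power2_eq_square)
    then show ?thesis unfolding lin by (simp add: algebra_simps power2_eq_square)
  qed
  \<comment> \<open>The power \<open>(2 * w) ^ (n - 1)\<close> can thus be shared out:
    \<open>2 * w\<close> to the possible factor \<open>x\<close>, and its square to each quadratic
    factor.\<close>
  have deg: "n - 1 = e + 2 * card R"
    unfolding e_def R_def card_pos_roots_pderiv_cheb_U[OF assms(1)] by simp
  have n: "2 ^ n = (2 :: complex) * 2 ^ (n - 1)" using assms(1) by (cases n) auto
  have "P * w ^ (n - 1) =
      2 * of_nat n * ((2 * w) ^ (n - 1) * (x ^ e * (\<Prod>r\<in>R. x\<^sup>2 - (of_real r)\<^sup>2)))"
    unfolding P_def pderiv_cheb_U_factor[OF assms(1)] R_def e_def n
    by (simp add: power_mult_distrib)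
  also have "(2 * w) ^ (n - 1) * (x ^ e * (\<Prod>r\<in>R. x\<^sup>2 - (of_real r)\<^sup>2)) =
      (2 * w * x) ^ e * (\<Prod>r\<in>R. (2 * w)\<^sup>2 * (x\<^sup>2 - (of_real r)\<^sup>2))"
    unfolding deg
    by (simp add: prod.distrib power_add power_mult power_mult_distrib prod_constant)
  finally have P: "P * w ^ (n - 1) =
      2 * of_nat n * ((1 + z) ^ e * (\<Prod>r\<in>R. 1 + z\<^sup>2 + 2 * z * of_real (1 - 2 * r\<^sup>2)))"
    by (simp only: lin quad)
  \<comment> \<open>Multiplying by \<open>w ^ (n + 2)\<close> clears the denominators: three factors
    \<open>w\<close> go to the cube, and \<open>n - 1\<close> are left for \<open>P\<close>.\<close>
  have exponent: "n + 2 = (n - 1) + 3" using assms(1) by simp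
  have "w ^ (n + 2) * (w - 1 / w) ^ 3 = w ^ (n - 1) * (w * (w - 1 / w)) ^ 3"
    unfolding exponent power_add power_mult_distrib by simp
  also have "w * (w - 1 / w) = - (1 - z)"
    using w by (simp add: z field_simps power2_eq_square)
  finally have w3: "w ^ (n + 2) * (w - 1 / w) ^ 3 = - (w ^ (n - 1) * (1 - z) ^ 3)"
    by (simp add: power_minus_odd del: minus_diff_eq)
  have "- (P * w ^ (n - 1) * (1 - z) ^ 3) = w ^ (n + 2) * (P * (w - 1 / w) ^ 3)"
    using w3 by (simp add: algebra_simps)
  also have "\<dots> = w ^ (n + 2) *
      (2 * (of_nat n * (w ^ (n + 2) - 1 / w ^ (n + 2)) - (of_nat n + 2) * (w ^ n - 1 / w ^ n)))"
    unfolding P_def x_def pderiv_cheb_U_joukowski[OF w] ..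
  also have "\<dots> = 2 * (of_nat n * (z ^ (n + 2) - 1) - (of_nat n + 2) * (z ^ (n + 1) - z))"
    using w by (simp add: z field_simps power_mult_distrib power2_eq_square)
  also have "\<dots> = - (2 * of_nat n * q_poly (n + 2) (- real (n + 2) / real n) z)"
    using assms(1) by (simp add: q_poly_def field_simps)
  finally have "2 * of_nat n * q_poly (n + 2) (- real (n + 2) / real n) z =
      P * w ^ (n - 1) * (1 - z) ^ 3"
    by simp
  then show ?thesis using assms(1) unfolding P e_def by simp
qed

text \<open>Here \<open>N - 1\<close> is odd, so \<open>z - z ^ (N - 1)\<close> changes sign while
  \<open>z ^ N\<close> does not.\<close>

lemma q_poly_uminus:
  assumes "even N" "N > 0"
  shows "q_poly N \<kappa> (- z) = q_poly N (- \<kappa>) z"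
  using assms by (simp add: q_poly_def algebra_simps)

text \<open>The roots are listed by an arbitrary bijection \<nu>; \<open>finite R\<close> and
  \<open>card R = m\<close> guarantee that such a listing exists.\<close>

theorem theorem7:
  fixes N m :: nat and R :: "real set"
  assumes "N \<ge> 3"
    and "m = (if odd N then (N - 3) div 2 else (N - 4) div 2)"
    and "R = {x. x > 0 \<and> poly (pderiv (cheb_U (N - 2))) x = 0}"
  shows "finite R \<and> card R = m \<and>
    (\<forall>(\<nu> :: nat \<Rightarrow> real) (\<gamma> :: nat \<Rightarrow> real) (\<kappa> :: real).
      bij_betw \<nu> {1..m} R \<and> (\<forall>j\<in>{1..m}. \<gamma> j = 1 - 2 * (\<nu> j)\<^sup>2) \<longrightarrow>
        (\<kappa> = - real N / (real N - 2) \<and> odd N \<longrightarrow>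
          (\<forall>z. q_poly N \<kappa> z =
            (1 - z) ^ 3 * (\<Prod>j=1..(N - 3) div 2. 1 + z\<^sup>2 + 2 * z * of_real (\<gamma> j)))) \<and>
        (\<kappa> = - real N / (real N - 2) \<and> even N \<longrightarrow>
          (\<forall>z. q_poly N \<kappa> z =
            (1 + z) * (1 - z) ^ 3 * (\<Prod>j=1..(N - 4) div 2. 1 + z\<^sup>2 + 2 * z * of_real (\<gamma> j)))) \<and>
        (\<kappa> = real N / (real N - 2) \<and> even N \<longrightarrow>
          (\<forall>z. q_poly N \<kappa> z =
            (1 - z) * (1 + z) ^ 3 * (\<Prod>j=1..(N - 4) div 2. 1 + z\<^sup>2 - 2 * z * of_real (\<gamma> j)))))"
proof -
  define n where "n = N - 2"
  have n: "n \<ge> 1" "N = n + 2" and n': "real N - 2 = real n" using assms(1) by (auto simp: n_def)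
  have R: "R = {x. x > 0 \<and> poly (pderiv (cheb_U n)) x = 0}" using assms(3) by (simp add: n_def)
  \<comment> \<open>Since \<open>n - 1 = N - 3\<close>, rounding down merges the two parity
    cases.\<close>
  have m: "m = (n - 1) div 2"
    using assms(1,2) unfolding n_def by (cases "odd N") (simp_all, presburger+)
  have m_odd: "(N - 3) div 2 = m" if "odd N" using assms(2) that by simp
  have m_even: "(N - 4) div 2 = m" if "even N" using assms(2) that by simp
  have e: "(n - 1) mod 2 = (if odd N then 0 else 1)"
    using n by (cases n) (auto simp: mod2_eq_if)
  have q: "q_poly N (- real N / (real N - 2)) z = (1 - z) ^ 3 * (1 + z) ^ ((n - 1) mod 2) *
      (\<Prod>j=1..m. 1 + z\<^sup>2 + 2 * z * of_real (\<gamma> j))"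
    if "bij_betw \<nu> {1..m} R" "\<forall>j\<in>{1..m}. \<gamma> j = 1 - 2 * (\<nu> j)\<^sup>2" for \<nu> \<gamma> z
  proof -
    have "(\<Prod>x\<in>R. 1 + z\<^sup>2 + 2 * z * of_real (1 - 2 * x\<^sup>2)) =
        (\<Prod>j=1..m. 1 + z\<^sup>2 + 2 * z * of_real (\<gamma> j))"
      using that by (subst prod.reindex_bij_betw[OF that(1), symmetric]) simp
    then show ?thesis using q_poly_factor[OF n(1), of z] unfolding n' R[symmetric] n(2) by simp
  qed
  \<comment> \<open>Passing from \<open>z\<close> to \<open>- z\<close> swaps \<open>1 - z\<close>
    with \<open>1 + z\<close> and flips the sign of the linear term in each quadratic
    factor.\<close>
  have q_pos: "q_poly N (real N / (real N - 2)) z = (1 - z) * (1 + z) ^ 3 *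
      (\<Prod>j=1..m. 1 + z\<^sup>2 - 2 * z * of_real (\<gamma> j))"
    if "bij_betw \<nu> {1..m} R" "\<forall>j\<in>{1..m}. \<gamma> j = 1 - 2 * (\<nu> j)\<^sup>2" "even N" for \<nu> \<gamma> z
    using q[OF that(1,2), of "- z"] q_poly_uminus[OF that(3), of "- real N / (real N - 2)" z]
      assms(1) that(3) e by (simp add: mult_ac)
  show ?thesis
  proof (intro conjI allI impI, goal_cases)
    case 1
    show ?case using finite_pos_roots_pderiv_cheb_U[OF n(1)] by (simp only: R)
  next
    case 2
    show ?case using card_pos_roots_pderiv_cheb_U[OF n(1)] by (simp only: R m)
  next
    case (3 \<nu> \<gamma> \<kappa> z)
    then show ?case using q[of \<nu> \<gamma> z] e m_odd by simp
  next
    case (4 \<nu> \<gamma> \<kappa> z)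
    then have "q_poly N \<kappa> z = (1 - z) ^ 3 * (1 + z) * (\<Prod>j=1..m. 1 + z\<^sup>2 + 2 * z * of_real (\<gamma> j))"
      using q[of \<nu> \<gamma> z] e by simp
    then show ?case using 4 m_even by (simp only: mult_ac)
  next
    case (5 \<nu> \<gamma> \<kappa> z)
    then have "q_poly N \<kappa> z = (1 - z) * (1 + z) ^ 3 * (\<Prod>j=1..m. 1 + z\<^sup>2 - 2 * z * of_real (\<gamma> j))"
      using q_pos[of \<nu> \<gamma> z] by blast
    then show ?case using 5 m_even by simp
  qed
qed

end
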